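(* Let $P$ be a labeled $n$-gon in $\mathbb{R}^2$ with $\operatorname{Area}(P)>0$. Suppose that: (i) all forward pentagram iterates $T^k(P)$, $k\ge0$, are defined and have nonzero area; (ii) there exist an integer $m\ge1$, a projectivity $G$, and a cyclic relabelling $\Sigma_s$ ($s=0$ allowed) such that $T^m(P)=\Sigma_s(G(P))$; (iii) $G$ has a dominant real spectral line $\ell_G$, which has a finite affine direction $u$; (iv) for every $r=0,\ldots,m-1$, the polygon $T^r(P)$ has an area-nondegenerate centered two-scale asymptotic under $G$ in the direction $u$. Let $P_k=\widehat T^k(P)$ denote the area-normalized pentagram iterates of $P$. Then, for all sufficiently large $k$, the principal line $\mathfrak p(P_k)$ is well defined, and its direction satisfies $$\operatorname{dir}\mathfrak p(P_k)\to\mathbb{R}u\quad\text{in }\mathbb{RP}^1\qquad(k\to\infty).$$ Equivalently, the current principal lines converge in direction to the spectral line $C(P)+\mathbb{R}u$.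
   Context: Labeled polygons: $P=(p_1,\dots,p_n)$ with $p_i\in\mathbb{R}^2$, indices modulo $n$; $\mathbb{R}^2\subset\mathbb{RP}^2$ via $x\mapsto[x:1]$. The pentagram map is $T(P)_i=(p_ip_{i+2})\cap(p_{i+1}p_{i+3})$, defined when, for every $i$, these two lines are well defined and not parallel. Put $C(P)=\frac1n\sum_i p_i$, $\operatorname{Area}(P)=\bigl|\frac12\sum_i\det(p_i,p_{i+1})\bigr|$. The area-normalized pentagram map is $\widehat T(P)_i=C(P)+\sqrt{\operatorname{Area}(P)/\operatorname{Area}(T(P))}\,(T(P)_i-C(T(P)))$. Cyclic relabelling: $\Sigma_s(P)_i=p_{i+s}$. A projectivity is a projective transformation of $\mathbb{RP}^2$ given by a real invertible $3\times3$ matrix, acting on polygons vertexwise. Principal line: let $\mathsf{Cov}(P)=\frac1n\sum_i(p_i-C(P))(p_i-C(P))^\top$. If the largest eigenvalue of $\mathsf{Cov}(P)$ is simple with unit eigenvector $u_P$, the principal line of $P$ is $\mathfrak p(P)=C(P)+\mathbb{R}u_P$ (otherwise it is not defined). $\operatorname{dir}\ell\in\mathbb{RP}^1$ denotes the direction of an affine line $\ell$. Dominant real spectral line: a projective line $\ell_G=\mathbb{P}(E)$, $E\subset\mathbb{R}^3$ a real two-dimensional $G$-invariant subspace, in one of two cases. (1) $G$ has three real eigenvalues $|\mu_1|>|\mu_2|>|\mu_3|$ with eigenvectors $v_1,v_2,v_3$, and $E=\operatorname{span}\{v_1,v_2\}$. (2) $G$ has a non-real conjugate pair $\mu,\overline\mu$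 and a real eigenvalue $\nu$ with $|\mu|>|\nu|$, and $E=\operatorname{span}_{\mathbb{R}}\{\operatorname{Re}v,\operatorname{Im}v\}$ for an eigenvector $v\in\mathbb{C}^3$ of $\mu$. "Finite affine direction $u$" means $\ell_G$ is not the line at infinity and $u$ is a direction vector of its affine part. Centered two-scale asymptotic: a sequence $(Q_k)$ of labeled $n$-gons with nonzero area, $Q_k=(q_{k,1},\dots,q_{k,n})$, has a centered two-scale asymptotic in the direction $u$ if there exist a vector $v$ transverse to $u$, nonzero real sequences $\alpha_k,\beta_k$, and real numbers $a_i,b_i$ such that, writing $q_{k,i}-C(Q_k)=x_{k,i}u+y_{k,i}v$, one has $x_{k,i}/\alpha_k\to a_i$, $y_{k,i}/\beta_k\to b_i$ for all $i$, and $|\beta_k|/|\alpha_k|\to0$. It is area-nondegenerate if $\frac12\sum_i\det(a_iu+b_iv,\;a_{i+1}u+b_{i+1}v)\ne0$. When $Q_k=G^k(Q)$, one says that $Q$ has the asymptotic under $G$. *)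

theory Defs
  imports "HOL-Analysis.Analysis" "HOL-Computational_Algebra.Polynomial"
begin

section \<open>Projective points, \<open>\<real>P\<^sup>1\<close> and \<open>\<real>P\<^sup>2\<close>\<close>

text \<open>
  Points of the projective space of a vector space are its one-dimensional linear subspaces,
  represented as sets \<open>span {x}\<close> with \<open>x \<noteq> 0\<close>. For a linear subspace \<open>E\<close>,
  \<open>projectivization E\<close> is the set of projective points lying in \<open>E\<close>.
\<close>

definition projectivization :: "'a::real_vector set \<Rightarrow> 'a set set" where
  "projectivization E = (\<lambda>x. span {x}) ` (E - {0})"

text \<open>The quotient topology of the punctured space; see \<open>quotient_map_projective_topology\<close>.\<close>

definition projective_topology :: "'a::real_normed_vector set topology" where
  "projective_topology =
     topology (\<lambda>U. U \<subseteq> projectivization UNIV \<and> open {x. x \<noteq> 0 \<and> span {x} \<in> U})"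

lemma openin_projective_topology:
  "openin projective_topology U \<longleftrightarrow>
     U \<subseteq> projectivization UNIV \<and> open {x::'a::real_normed_vector. x \<noteq> 0 \<and> span {x} \<in> U}"
proof -
  have "istopology (\<lambda>U. U \<subseteq> projectivization UNIV \<and> open {x::'a. x \<noteq> 0 \<and> span {x} \<in> U})"
    unfolding istopology_def
  proof (intro conjI allI impI)
    fix S T :: "'a set set"
    assume S: "S \<subseteq> projectivization UNIV \<and> open {x. x \<noteq> 0 \<and> span {x} \<in> S}"
      and T: "T \<subseteq> projectivization UNIV \<and> open {x. x \<noteq> 0 \<and> span {x} \<in> T}"
    show "S \<inter> T \<subseteq> projectivization UNIV"
      using S by blast
    have "{x. x \<noteq> 0 \<and> span {x} \<in> S \<inter> T}
        = {x. x \<noteq> 0 \<and> span {x} \<in> S} \<inter> {x. x \<noteq> 0 \<and> span {x} \<in> T}"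
      by blast
    then show "open {x. x \<noteq> 0 \<and> span {x} \<in> S \<inter> T}"
      using S T by auto
  next
    fix K :: "'a set set set"
    assume K: "\<forall>S\<in>K. S \<subseteq> projectivization UNIV \<and> open {x. x \<noteq> 0 \<and> span {x} \<in> S}"
    show "\<Union>K \<subseteq> projectivization UNIV"
      using K by blast
    have "{x. x \<noteq> 0 \<and> span {x} \<in> \<Union>K} = (\<Union>S\<in>K. {x. x \<noteq> 0 \<and> span {x} \<in> S})"
      by blast
    then show "open {x. x \<noteq> 0 \<and> span {x} \<in> \<Union>K}"
      using K by auto
  qed
  then show ?thesis
    by (simp add: projective_topology_def topology_inverse')
qed

lemma topspace_projective_topology:
  "topspace projective_topology = projectivization (UNIV :: 'a::real_normed_vector set)"
proof -
  have "{x::'a. x \<noteq> 0 \<and> span {x} \<in> projectivization UNIV} = - {0}"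
    by (auto simp: projectivization_def)
  then have "openin projective_topology (projectivization (UNIV :: 'a set))"
    by (simp add: openin_projective_topology open_Compl)
  then show ?thesis
    by (meson openin_projective_topology openin_subset openin_topspace subset_antisym)
qed

lemma quotient_map_projective_topology:
  "quotient_map (top_of_set (- {0 :: 'a::real_normed_vector})) projective_topology (\<lambda>x. span {x})"
proof -
  have eq: "{x::'a. x \<in> - {0} \<and> span {x} \<in> U} = {x. x \<noteq> 0 \<and> span {x} \<in> U}" for U
    by auto
  have "openin (top_of_set (- {0})) {x::'a. x \<noteq> 0 \<and> span {x} \<in> U}
      \<longleftrightarrow> open {x::'a. x \<noteq> 0 \<and> span {x} \<in> U}" for U
    by (subst openin_open_eq) (auto simp: open_Compl)
  then show ?thesis
    unfolding quotient_map_def topspace_projective_topology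
    by (simp add: openin_projective_topology projectivization_def Compl_eq_Diff_UNIV eq
          flip: Compl_eq_Diff_UNIV)
qed

abbreviation RP1 :: "(real^2) set topology" where
  "RP1 \<equiv> projective_topology"

text \<open>The embedding \<open>x \<mapsto> [x : 1]\<close> and the action of a \<open>3 \<times> 3\<close> matrix on \<open>\<real>P\<^sup>2\<close>.\<close>

definition proj_point :: "real^2 \<Rightarrow> (real^3) set" where
  "proj_point x = span {vector [x $ 1, x $ 2, 1]}"

definition proj_map :: "real^3^3 \<Rightarrow> (real^3) set \<Rightarrow> (real^3) set" where
  "proj_map G L = (\<lambda>z. G *v z) ` L"


section \<open>Affine lines\<close>

definition affine_line :: "'a::real_vector \<Rightarrow> 'a \<Rightarrow> 'a set" where
  "affine_line c w = {c + t *\<^sub>R w | t. True}"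

definition line_dir :: "'a::real_vector set \<Rightarrow> 'a set" where
  "line_dir l = {x - y | x y. x \<in> l \<and> y \<in> l}"


section \<open>Labeled polygons and the pentagram map\<close>

text \<open>
  Indices modulo \<open>n\<close> are realized by \<open>n\<close>-periodic functions on the integers, so that equality of
  labeled polygons is equality of functions. The vertices are those with index in \<open>{0..<int n}\<close>.
\<close>

definition polygon :: "nat \<Rightarrow> (int \<Rightarrow> real^2) \<Rightarrow> bool" where
  "polygon n P \<longleftrightarrow> 0 < n \<and> (\<forall>i. P (i + int n) = P i)"

definition relabel :: "int \<Rightarrow> (int \<Rightarrow> 'a) \<Rightarrow> int \<Rightarrow> 'a" where
  "relabel s P i = P (i + s)"

definition centroid :: "nat \<Rightarrow> (int \<Rightarrow> real^2) \<Rightarrow> real^2" where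
  "centroid n P = (1 / real n) *\<^sub>R (\<Sum>i\<in>{0..<int n}. P i)"

definition det2 :: "real^2 \<Rightarrow> real^2 \<Rightarrow> real" where
  "det2 x y = det (vector [x, y] :: real^2^2)"

definition signed_area :: "nat \<Rightarrow> (int \<Rightarrow> real^2) \<Rightarrow> real" where
  "signed_area n P = 1 / 2 * (\<Sum>i\<in>{0..<int n}. det2 (P i) (P (i + 1)))"

definition area :: "nat \<Rightarrow> (int \<Rightarrow> real^2) \<Rightarrow> real" where
  "area n P = \<bar>signed_area n P\<bar>"

text \<open>\<open>affine_parallel\<close> includes the case of coinciding lines.\<close>

definition pentagram_defined :: "(int \<Rightarrow> real^2) \<Rightarrow> bool" where
  "pentagram_defined P \<longleftrightarrow>
     (\<forall>i. P i \<noteq> P (i + 2) \<and> P (i + 1) \<noteq> P (i + 3) \<and>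
          \<not> affine_parallel (affine hull {P i, P (i + 2)}) (affine hull {P (i + 1), P (i + 3)}))"

definition pentagram :: "(int \<Rightarrow> real^2) \<Rightarrow> int \<Rightarrow> real^2" where
  "pentagram P i =
     (THE x. x \<in> affine hull {P i, P (i + 2)} \<inter> affine hull {P (i + 1), P (i + 3)})"

definition normalized_pentagram :: "nat \<Rightarrow> (int \<Rightarrow> real^2) \<Rightarrow> int \<Rightarrow> real^2" where
  "normalized_pentagram n P i =
     centroid n P + sqrt (area n P / area n (pentagram P)) *\<^sub>R
       (pentagram P i - centroid n (pentagram P))"


section \<open>Eigenvectors and the principal line\<close>

definition eigenvector :: "'a::field^'n^'n \<Rightarrow> 'a^'n \<Rightarrow> 'a \<Rightarrow> bool" where
  "eigenvector A v c \<longleftrightarrow> v \<noteq> 0 \<and> A *v v = c *s v"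

definition eigenvalue :: "'a::field^'n^'n \<Rightarrow> 'a \<Rightarrow> bool" where
  "eigenvalue A c \<longleftrightarrow> (\<exists>v. eigenvector A v c)"

definition charpoly :: "'a::field^'n^'n \<Rightarrow> 'a poly" where
  "charpoly A = det (mat [:0, 1:] - map_matrix (\<lambda>a. [:a:]) A)"

definition simple_eigenvalue :: "'a::field^'n^'n \<Rightarrow> 'a \<Rightarrow> bool" where
  "simple_eigenvalue A c \<longleftrightarrow> order c (charpoly A) = 1"

definition largest_eigenvalue :: "real^'n^'n \<Rightarrow> real \<Rightarrow> bool" where
  "largest_eigenvalue A c \<longleftrightarrow> eigenvalue A c \<and> (\<forall>d. eigenvalue A d \<longrightarrow> d \<le> c)"

definition cov :: "nat \<Rightarrow> (int \<Rightarrow> real^2) \<Rightarrow> real^2^2" where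
  "cov n P = (1 / real n) *\<^sub>R
     (\<Sum>i\<in>{0..<int n}. \<chi> a b. (P i - centroid n P) $ a * (P i - centroid n P) $ b)"

definition is_principal_line :: "nat \<Rightarrow> (int \<Rightarrow> real^2) \<Rightarrow> (real^2) set \<Rightarrow> bool" where
  "is_principal_line n P l \<longleftrightarrow>
     (\<exists>c w. largest_eigenvalue (cov n P) c \<and> simple_eigenvalue (cov n P) c \<and>
            eigenvector (cov n P) w c \<and> norm w = 1 \<and> l = affine_line (centroid n P) w)"

definition principal_line_defined :: "nat \<Rightarrow> (int \<Rightarrow> real^2) \<Rightarrow> bool" where
  "principal_line_defined n P \<longleftrightarrow>
     (\<exists>c. largest_eigenvalue (cov n P) c \<and> simple_eigenvalue (cov n P) c)"

definition principal_line :: "nat \<Rightarrow> (int \<Rightarrow> real^2) \<Rightarrow> (real^2) set" where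
  "principal_line n P = (THE l. is_principal_line n P l)"


section \<open>Dominant real spectral lines\<close>

text \<open>
  In the second case the matrix is real, so \<open>cnj \<mu>\<close> is an eigenvalue together with \<open>\<mu>\<close>.
\<close>

definition dominant_invariant_plane :: "real^3^3 \<Rightarrow> (real^3) set \<Rightarrow> bool" where
  "dominant_invariant_plane G E \<longleftrightarrow>
     subspace E \<and> dim E = 2 \<and> (\<forall>z\<in>E. G *v z \<in> E) \<and>
     ((\<exists>\<mu>\<^sub>1 \<mu>\<^sub>2 \<mu>\<^sub>3 v\<^sub>1 v\<^sub>2 v\<^sub>3.
         eigenvector G v\<^sub>1 \<mu>\<^sub>1 \<and> eigenvector G v\<^sub>2 \<mu>\<^sub>2 \<and> eigenvector G v\<^sub>3 \<mu>\<^sub>3 \<and>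
         \<bar>\<mu>\<^sub>1\<bar> > \<bar>\<mu>\<^sub>2\<bar> \<and> \<bar>\<mu>\<^sub>2\<bar> > \<bar>\<mu>\<^sub>3\<bar> \<and> E = span {v\<^sub>1, v\<^sub>2}) \<or>
      (\<exists>\<mu> \<nu> v. eigenvector (map_matrix complex_of_real G) v \<mu> \<and> \<mu> \<notin> \<real> \<and>
         eigenvalue G \<nu> \<and> cmod \<mu> > \<bar>\<nu>\<bar> \<and>
         E = span {\<chi> i. Re (v $ i), \<chi> i. Im (v $ i)}))"

definition dominant_spectral_line :: "real^3^3 \<Rightarrow> (real^3) set set \<Rightarrow> bool" where
  "dominant_spectral_line G l \<longleftrightarrow> (\<exists>E. dominant_invariant_plane G E \<and> l = projectivization E)"

definition line_at_infinity :: "(real^3) set set" where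
  "line_at_infinity = projectivization {z. z $ 3 = 0}"

definition affine_part :: "(real^3) set set \<Rightarrow> (real^2) set" where
  "affine_part l = {x. proj_point x \<in> l}"

definition finite_affine_direction :: "(real^3) set set \<Rightarrow> real^2 \<Rightarrow> bool" where
  "finite_affine_direction l u \<longleftrightarrow>
     l \<noteq> line_at_infinity \<and> u \<noteq> 0 \<and> line_dir (affine_part l) = span {u}"


section \<open>Centered two-scale asymptotics\<close>

text \<open>
  Since \<open>u\<close> and \<open>v\<close> form a basis, the coordinates \<open>x\<close>, \<open>y\<close> are uniquely determined, and the
  limits \<open>a\<close>, \<open>b\<close> inherit the periodicity of the polygons.
\<close>

definition two_scale_asymptotic ::
  "nat \<Rightarrow> real^2 \<Rightarrow> (nat \<Rightarrow> int \<Rightarrow> real^2) \<Rightarrow> real^2 \<Rightarrow> (nat \<Rightarrow> real) \<Rightarrow> (nat \<Rightarrow> real) \<Rightarrow>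
     (int \<Rightarrow> real) \<Rightarrow> (int \<Rightarrow> real) \<Rightarrow> bool" where
  "two_scale_asymptotic n u Q v \<alpha> \<beta> a b \<longleftrightarrow>
     (\<forall>k. polygon n (Q k) \<and> area n (Q k) \<noteq> 0) \<and>
     u \<noteq> 0 \<and> v \<notin> span {u} \<and> (\<forall>k. \<alpha> k \<noteq> 0 \<and> \<beta> k \<noteq> 0) \<and>
     (\<exists>x y. (\<forall>k i. Q k i - centroid n (Q k) = x k i *\<^sub>R u + y k i *\<^sub>R v) \<and>
        (\<forall>i. (\<lambda>k. x k i / \<alpha> k) \<longlonglongrightarrow> a i) \<and> (\<forall>i. (\<lambda>k. y k i / \<beta> k) \<longlonglongrightarrow> b i)) \<and>
     (\<lambda>k. \<bar>\<beta> k\<bar> / \<bar>\<alpha> k\<bar>) \<longlonglongrightarrow> 0"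

definition area_nondegenerate_two_scale :: "nat \<Rightarrow> real^2 \<Rightarrow> (nat \<Rightarrow> int \<Rightarrow> real^2) \<Rightarrow> bool" where
  "area_nondegenerate_two_scale n u Q \<longleftrightarrow>
     (\<exists>v \<alpha> \<beta> a b. two_scale_asymptotic n u Q v \<alpha> \<beta> a b \<and>
        signed_area n (\<lambda>i. a i *\<^sub>R u + b i *\<^sub>R v) \<noteq> 0)"

text \<open>
  The images \<open>G\<^sup>k(Q)\<close> are polygons in \<open>\<real>P\<^sup>2\<close>; the asymptotic presupposes that all of them lie in the
  affine chart, where they are the polygons \<open>R k\<close>.
\<close>

definition area_nondegenerate_two_scale_under ::
  "nat \<Rightarrow> real^3^3 \<Rightarrow> real^2 \<Rightarrow> (int \<Rightarrow> real^2) \<Rightarrow> bool" where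
  "area_nondegenerate_two_scale_under n G u Q \<longleftrightarrow>
     (\<exists>R. (\<forall>k i. proj_point (R k i) = (proj_map G ^^ k) (proj_point (Q i))) \<and>
          area_nondegenerate_two_scale n u R)"

end

theory Submission
  imports Defs
begin

text \<open>
  The pentagram map commutes with projectivities, so \<open>T\<^bsup>mk+r\<^esup>(P)\<close> is a relabelling of \<open>G\<^sup>k(T\<^sup>r(P))\<close>; it
  also commutes with similarities, so the area-normalized iterates differ from the plain ones only
  by a translation and a positive dilation. Hence covariances are only changed by positive factors.
  By the two-scale asymptotics, along each residue class modulo \<open>m\<close> the covariance matrices, suitably
  rescaled, converge to a positive multiple of \<open>u u\<^sup>T\<close>. The top eigenline is continuous at this matrix.
  Nonzero limiting area guarantees that the limits \<open>a\<^sub>i\<close> do not all vanish.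
\<close>

section \<open>Pentagram map and similarities\<close>

lemma det2_eq: "det2 x y = x $ 1 * y $ 2 - x $ 2 * y $ 1"
  by (simp add: det2_def det_2)

lemma vec2_eq_iff: "(x :: 'a^2) = y \<longleftrightarrow> x $ 1 = y $ 1 \<and> x $ 2 = y $ 2"
  by (simp add: vec_eq_iff forall_2)

lemma vec3_eq_iff: "(x :: 'a^3) = y \<longleftrightarrow> x $ 1 = y $ 1 \<and> x $ 2 = y $ 2 \<and> x $ 3 = y $ 3"
  by (simp add: vec_eq_iff forall_3)

lemma det2_eq_0_imp_multiple:
  assumes "det2 x y = 0" "y \<noteq> 0"
  obtains k where "x = k *\<^sub>R y"
proof (cases "y $ 1 = 0")
  case True
  with assms have y2: "y $ 2 \<noteq> 0" by (simp add: vec2_eq_iff)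
  with True assms(1) have "x $ 1 = 0" by (simp add: det2_eq)
  with True y2 have "x = (x $ 2 / y $ 2) *\<^sub>R y" by (simp add: vec2_eq_iff)
  then show ?thesis by (rule that)
next
  case False
  with assms(1) have "x = (x $ 1 / y $ 1) *\<^sub>R y"
    by (simp add: vec2_eq_iff det2_eq field_simps)
  then show ?thesis by (rule that)
qed

lemma det2_independent:
  assumes "det2 x y \<noteq> 0" "s *\<^sub>R x = t *\<^sub>R y"
  shows "s = 0" "t = 0"
proof -
  have e: "s * x $ 1 = t * y $ 1" "s * x $ 2 = t * y $ 2"
    using assms(2) by (simp_all add: vec2_eq_iff)
  have "s * det2 x y = (s * x $ 1) * y $ 2 - (s * x $ 2) * y $ 1"
    by (simp add: det2_eq algebra_simps)
  also have "\<dots> = 0" by (simp add: e)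
  finally show "s = 0" using assms(1) by simp
  have "t * det2 x y = x $ 1 * (t * y $ 2) - x $ 2 * (t * y $ 1)"
    by (simp add: det2_eq algebra_simps)
  also have "\<dots> = 0" by (simp flip: e)
  finally show "t = 0" using assms(1) by simp
qed

lemma affine_hull_2_line: "affine hull {a, b} = {a + t *\<^sub>R (b - a) | t. True}"
proof (intro subset_antisym subsetI)
  fix x assume "x \<in> affine hull {a, b}"
  then obtain s t where "x = s *\<^sub>R a + t *\<^sub>R b" "s + t = 1"
    by (auto simp: affine_hull_2)
  then have "x = a + t *\<^sub>R (b - a)"
    by (simp add: algebra_simps flip: scaleR_add_left)
  then show "x \<in> {a + t *\<^sub>R (b - a) | t. True}" by blast
next
  fix x assume "x \<in> {a + t *\<^sub>R (b - a) | t. True}"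
  then obtain t where "x = a + t *\<^sub>R (b - a)" by blast
  then have "x = (1 - t) *\<^sub>R a + t *\<^sub>R b" "(1 - t) + t = 1"
    by (simp_all add: algebra_simps)
  then show "x \<in> affine hull {a, b}"
    unfolding affine_hull_2 by blast
qed

lemma det2_eq_0_imp_parallel:
  assumes "det2 (b - a) (d - c) = 0" "a \<noteq> b" "c \<noteq> d"
  shows "affine_parallel (affine hull {a, b}) (affine hull {c, d})"
proof -
  obtain k where k: "b - a = k *\<^sub>R (d - c)"
    using assms by (auto elim: det2_eq_0_imp_multiple)
  with assms have "k \<noteq> 0" by auto
  have "(x \<in> affine hull {a, b}) = ((c - a) + x \<in> affine hull {c, d})" for x
  proof
    assume "x \<in> affine hull {a, b}"
    then obtain t where "x = a + t *\<^sub>R (b - a)" by (auto simp: affine_hull_2_line)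
    then have "(c - a) + x = c + (t * k) *\<^sub>R (d - c)" by (simp add: k)
    then show "(c - a) + x \<in> affine hull {c, d}" unfolding affine_hull_2_line by blast
  next
    assume "(c - a) + x \<in> affine hull {c, d}"
    then obtain t where "(c - a) + x = c + t *\<^sub>R (d - c)" by (auto simp: affine_hull_2_line)
    then have "x = a + (t / k) *\<^sub>R (b - a)"
      using \<open>k \<noteq> 0\<close> by (simp add: k algebra_simps)
    then show "x \<in> affine hull {a, b}" unfolding affine_hull_2_line by blast
  qed
  then show ?thesis
    unfolding affine_parallel_expl by blast
qed

lemma ex1_line_intersection:
  assumes "det2 (b - a) (d - c) \<noteq> 0"
  shows "\<exists>!x. x \<in> affine hull {a, b} \<inter> affine hull {c, d}"
proof -
  define D where "D = det2 (b - a) (d - c)"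
  \<comment> \<open>Cramer's rule for a + t (b - a) = c + s (d - c): pairing with d - c isolates t,
    pairing with b - a isolates s.\<close>
  define t where "t = det2 (c - a) (d - c) / D"
  define s where "s = det2 (c - a) (b - a) / D"
  have D: "D \<noteq> 0" using assms by (simp add: D_def)
  have "D *\<^sub>R (a + t *\<^sub>R (b - a)) = D *\<^sub>R (c + s *\<^sub>R (d - c))"
    unfolding scaleR_add_right scaleR_scaleR t_def s_def using D
    by (simp add: vec2_eq_iff) (simp add: D_def det2_eq algebra_simps)
  then have "a + t *\<^sub>R (b - a) = c + s *\<^sub>R (d - c)" using D by simp
  then have "a + t *\<^sub>R (b - a) \<in> affine hull {a, b} \<inter> affine hull {c, d}"
    unfolding affine_hull_2_line by blast
  moreover have "x = y" if x: "x \<in> affine hull {a, b} \<inter> affine hull {c, d}"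
    and y: "y \<in> affine hull {a, b} \<inter> affine hull {c, d}" for x y
  proof -
    obtain t s where e12: "x = a + t *\<^sub>R (b - a)" "x = c + s *\<^sub>R (d - c)"
      using x unfolding affine_hull_2_line by blast
    obtain t' s' where e34: "y = a + t' *\<^sub>R (b - a)" "y = c + s' *\<^sub>R (d - c)"
      using y unfolding affine_hull_2_line by blast
    note e = e12 e34
    have "x - y = (t - t') *\<^sub>R (b - a)" unfolding e(1) e(3) by (simp add: algebra_simps)
    moreover have "x - y = (s - s') *\<^sub>R (d - c)" unfolding e(2) e(4) by (simp add: algebra_simps)
    ultimately have "(t - t') *\<^sub>R (b - a) = (s - s') *\<^sub>R (d - c)" by simp
    then have "t - t' = 0" by (rule det2_independent(1)[OF assms])
    then show ?thesis using e by simp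
  qed
  ultimately show ?thesis by blast
qed

text \<open>Nondegeneracy as a nonvanishing determinant: it contains the distinctness of the
  endpoints of each diagonal, scales predictably under similarities, and is the hypothesis of
  Cramer's rule.\<close>

definition generic_polygon :: "(int \<Rightarrow> real^2) \<Rightarrow> bool" where
  "generic_polygon P \<longleftrightarrow> (\<forall>i. det2 (P (i + 2) - P i) (P (i + 3) - P (i + 1)) \<noteq> 0)"

lemma pentagram_defined_imp_generic: "pentagram_defined P \<Longrightarrow> generic_polygon P"
  unfolding pentagram_defined_def generic_polygon_def using det2_eq_0_imp_parallel by blast

lemma generic_polygon_ex1:
  "generic_polygon P \<Longrightarrow> \<exists>!x. x \<in> affine hull {P i, P (i + 2)} \<inter> affine hull {P (i + 1), P (i + 3)}"
  by (rule ex1_line_intersection) (simp add: generic_polygon_def)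

lemma pentagram_mem:
  assumes "generic_polygon P"
  shows "pentagram P i \<in> affine hull {P i, P (i + 2)} \<inter> affine hull {P (i + 1), P (i + 3)}"
  unfolding pentagram_def
  using generic_polygon_ex1[OF assms] by (rule theI')

lemma pentagram_eqI:
  assumes "generic_polygon P"
    and "x \<in> affine hull {P i, P (i + 2)}" "x \<in> affine hull {P (i + 1), P (i + 3)}"
  shows "pentagram P i = x"
  using generic_polygon_ex1[OF assms(1), of i] pentagram_mem[OF assms(1), of i] assms(2,3) by blast

section \<open>Relabelling, periodicity and similarities\<close>

lemma pentagram_relabel: "pentagram (relabel s P) = relabel s (pentagram P)"
  by (rule ext) (simp add: pentagram_def relabel_def add_ac)

lemma generic_polygon_relabel:
  assumes "generic_polygon P"
  shows "generic_polygon (relabel s P)"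
  unfolding generic_polygon_def relabel_def
proof
  fix i
  show "det2 (P (i + 2 + s) - P (i + s)) (P (i + 3 + s) - P (i + 1 + s)) \<noteq> 0"
    using assms[unfolded generic_polygon_def, rule_format, of "i + s"] by (simp add: add_ac)
qed

lemma polygon_pentagram: "polygon n P \<Longrightarrow> polygon n (pentagram P)"
proof -
  assume P: "polygon n P"
  then have *: "P (i + int n) = P i" for i by (simp add: polygon_def)
  have "P (i + int n + j) = P (i + j)" for i j using *[of "i + j"] by (simp add: add_ac)
  with P * show ?thesis by (simp add: polygon_def pentagram_def)
qed

lemma polygon_funpow_pentagram: "polygon n P \<Longrightarrow> polygon n ((pentagram ^^ k) P)"
  by (induction k) (auto intro: polygon_pentagram)

lemma affine_hull_2_similarity:
  assumes "x \<in> affine hull {a, b}"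
  shows "d + c *\<^sub>R x \<in> affine hull {d + c *\<^sub>R a, d + c *\<^sub>R b}"
proof -
  obtain t where x: "x = a + t *\<^sub>R (b - a)" using assms by (auto simp: affine_hull_2_line)
  have "d + c *\<^sub>R x = (d + c *\<^sub>R a) + t *\<^sub>R ((d + c *\<^sub>R b) - (d + c *\<^sub>R a))"
    unfolding x by (simp add: algebra_simps)
  then show ?thesis unfolding affine_hull_2_line by blast
qed

text \<open>Similarities carry lines to lines, so the image of the intersection point lies on both
  image diagonals; genericity of the image polygon makes it the only such point.\<close>

lemma pentagram_similarity:
  assumes "generic_polygon P" "c \<noteq> 0"
  shows "pentagram (\<lambda>i. d + c *\<^sub>R P i) = (\<lambda>i. d + c *\<^sub>R pentagram P i)"
proof
  fix i
  have "det2 (c *\<^sub>R x - c *\<^sub>R y) (c *\<^sub>R z - c *\<^sub>R w) = c\<^sup>2 * det2 (x - y) (z - w)" for x y z w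
    by (simp add: det2_eq algebra_simps power2_eq_square)
  then have "generic_polygon (\<lambda>i. d + c *\<^sub>R P i)"
    using assms by (simp add: generic_polygon_def)
  moreover have "d + c *\<^sub>R pentagram P i \<in> affine hull {d + c *\<^sub>R P i, d + c *\<^sub>R P (i + 2)}"
      "d + c *\<^sub>R pentagram P i \<in> affine hull {d + c *\<^sub>R P (i + 1), d + c *\<^sub>R P (i + 3)}"
    using pentagram_mem[OF assms(1), of i] by (auto intro: affine_hull_2_similarity)
  ultimately show "pentagram (\<lambda>i. d + c *\<^sub>R P i) i = d + c *\<^sub>R pentagram P i"
    by (rule pentagram_eqI)
qed

section \<open>Projective equivariance\<close>

text \<open>The representative of \<open>proj_point x\<close> with last coordinate 1; a concrete
  vector permits coordinate calculations that spans hide.\<close>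

definition homog :: "real^2 \<Rightarrow> real^3" where
  "homog x = vector [x $ 1, x $ 2, 1]"

lemma homog_nth [simp]: "homog x $ 1 = x $ 1" "homog x $ 2 = x $ 2" "homog x $ 3 = 1"
  by (simp_all add: homog_def)

lemma homog_nonzero: "homog x \<noteq> 0"
  by (simp add: vec3_eq_iff)

lemma homog_affine: "homog (a + t *\<^sub>R (b - a)) = (1 - t) *\<^sub>R homog a + t *\<^sub>R homog b"
  by (simp add: vec3_eq_iff algebra_simps)

lemma proj_point_eq_span: "proj_point x = span {homog x}"
  by (simp add: proj_point_def homog_def)

lemma proj_map_span: "proj_map G (span {v}) = span {G *v v}"
  unfolding proj_map_def
  using linear_span_image[of "(*v) G" "{v}"] by simp

lemma inj_proj_point: "inj proj_point"
proof
  fix x y assume "proj_point x = proj_point y"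
  then have "homog x \<in> span {homog y}"
    unfolding proj_point_eq_span using span_base by blast
  then obtain k where "homog x = k *\<^sub>R homog y" by (auto simp: span_singleton)
  then have "k = 1" "x $ 1 = k * y $ 1" "x $ 2 = k * y $ 2" by (simp_all add: vec3_eq_iff)
  then show "x = y" by (simp add: vec2_eq_iff)
qed

lemma span_singleton_scaleR: "k \<noteq> 0 \<Longrightarrow> span {k *\<^sub>R v} = span {v :: 'a::real_vector}"
  using span_image_scale[of "{v}" "\<lambda>_. k"] by simp

lemma weighted_point_mem_affine_hull:
  assumes "\<alpha> + \<beta> \<noteq> 0"
  shows "(\<alpha> *\<^sub>R a + \<beta> *\<^sub>R b) /\<^sub>R (\<alpha> + \<beta>) \<in> affine hull {a, b}"
proof -
  have "\<alpha> / (\<alpha> + \<beta>) + \<beta> / (\<alpha> + \<beta>) = 1" using assms by (simp flip: add_divide_distrib)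
  moreover have "(\<alpha> *\<^sub>R a + \<beta> *\<^sub>R b) /\<^sub>R (\<alpha> + \<beta>) = (\<alpha> / (\<alpha> + \<beta>)) *\<^sub>R a + (\<beta> / (\<alpha> + \<beta>)) *\<^sub>R b"
    by (simp add: scaleR_add_right divide_inverse_commute)
  ultimately show ?thesis unfolding affine_hull_2 by blast
qed

text \<open>A projectivity preserves incidence, so the image of the intersection point lies on the
  projective lines through both diagonals of \<open>Q\<close>. The real content is that this image
  is not at infinity, because those diagonals are not parallel.\<close>

lemma pentagram_proj_map:
  assumes "generic_polygon Q" "generic_polygon Q'" "invertible G"
    and QQ': "\<And>i. proj_point (Q i) = proj_map G (proj_point (Q' i))"
  shows "proj_point (pentagram Q i) = proj_map G (proj_point (pentagram Q' i))"
proof -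
  \<comment> \<open>Equality of projective points leaves a scale factor depending on the vertex.
    These factors turn affine weights into weights whose sum need not be 1.\<close>
  have "\<exists>h. G *v homog (Q' i) = h *\<^sub>R homog (Q i)" for i
  proof -
    have "span {homog (Q i)} = span {G *v homog (Q' i)}"
      using QQ'[of i] by (simp add: proj_point_eq_span proj_map_span)
    then have "G *v homog (Q' i) \<in> span {homog (Q i)}" using span_base by blast
    then show ?thesis by (auto simp: span_singleton)
  qed
  then obtain h where h: "\<And>i. G *v homog (Q' i) = h i *\<^sub>R homog (Q i)" by metis
  let ?x = "pentagram Q' i"
  obtain t s where t: "?x = Q' i + t *\<^sub>R (Q' (i + 2) - Q' i)"
      and s: "?x = Q' (i + 1) + s *\<^sub>R (Q' (i + 3) - Q' (i + 1))"
    using pentagram_mem[OF assms(2), of i] unfolding affine_hull_2_line by blast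
  define w where "w = G *v homog ?x"
  define \<alpha> \<beta> \<gamma> \<delta> where "\<alpha> = (1 - t) * h i" and "\<beta> = t * h (i + 2)"
    and "\<gamma> = (1 - s) * h (i + 1)" and "\<delta> = s * h (i + 3)"
  have w1: "w = \<alpha> *\<^sub>R homog (Q i) + \<beta> *\<^sub>R homog (Q (i + 2))"
    unfolding w_def t homog_affine
    by (simp add: \<alpha>_def \<beta>_def matrix_vector_right_distrib matrix_vector_mult_scaleR h)
  have w2: "w = \<gamma> *\<^sub>R homog (Q (i + 1)) + \<delta> *\<^sub>R homog (Q (i + 3))"
    unfolding w_def s homog_affine
    by (simp add: \<gamma>_def \<delta>_def matrix_vector_right_distrib matrix_vector_mult_scaleR h)
  define y where "y = \<alpha> *\<^sub>R Q i + \<beta> *\<^sub>R Q (i + 2)"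
  have sums: "w $ 3 = \<alpha> + \<beta>" "w $ 3 = \<gamma> + \<delta>"
    by (simp add: w1, simp add: w2)
  have y1: "y $ 1 = w $ 1" "y $ 2 = w $ 2" by (simp_all add: w1 y_def)
  have y2: "y = \<gamma> *\<^sub>R Q (i + 1) + \<delta> *\<^sub>R Q (i + 3)" using y1 by (simp add: w2 vec2_eq_iff)
  have "w \<noteq> 0"
    using inj_matrix_vector_mult[OF assms(3)] homog_nonzero[of ?x]
    unfolding w_def by (metis injD matrix_vector_mult_0_right)
  \<comment> \<open>If \<open>w\<close> were at infinity, the weights on each diagonal would cancel
    and \<open>y\<close> would be a multiple of both diagonal directions of \<open>Q\<close>. Those
    are independent, so \<open>y\<close>, and with it \<open>w\<close>, would vanish, against the
    invertibility of \<open>G\<close>.\<close>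
  have "w $ 3 \<noteq> 0"
  proof
    assume "w $ 3 = 0"
    then have neg: "\<alpha> = - \<beta>" "\<gamma> = - \<delta>" using sums by auto
    have e: "y = \<beta> *\<^sub>R (Q (i + 2) - Q i)" "y = \<delta> *\<^sub>R (Q (i + 3) - Q (i + 1))"
      by (simp add: y_def neg algebra_simps, simp add: y2 neg algebra_simps)
    moreover have "det2 (Q (i + 2) - Q i) (Q (i + 3) - Q (i + 1)) \<noteq> 0"
      using assms(1) by (simp add: generic_polygon_def)
    ultimately have "\<beta> = 0" by (metis det2_independent(1))
    then have "y = 0" using e by simp
    then show False using \<open>w \<noteq> 0\<close> \<open>w $ 3 = 0\<close> y1 by (simp add: vec3_eq_iff)
  qed
  have "pentagram Q i = y /\<^sub>R (w $ 3)"
    using weighted_point_mem_affine_hull[of \<alpha> \<beta> "Q i" "Q (i + 2)"]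
      weighted_point_mem_affine_hull[of \<gamma> \<delta> "Q (i + 1)" "Q (i + 3)"] \<open>w $ 3 \<noteq> 0\<close>
    by (intro pentagram_eqI[OF assms(1)]) (simp_all flip: sums y_def y2)
  then have "w = (w $ 3) *\<^sub>R homog (pentagram Q i)"
    using \<open>w $ 3 \<noteq> 0\<close> by (simp add: vec3_eq_iff y1)
  then have "span {w} = span {homog (pentagram Q i)}"
    using \<open>w $ 3 \<noteq> 0\<close> by (metis span_singleton_scaleR)
  then show ?thesis by (simp add: proj_point_eq_span proj_map_span w_def)
qed

text \<open>Each block of m pentagram steps acts as \<open>G\<close> together with one shift by
  \<open>s\<close>; relabelling commutes with both maps, so the shifts add up to
  \<open>int k * s\<close>.\<close>

lemma pentagram_iterates_proj_map:
  assumes "\<And>k. generic_polygon ((pentagram ^^ k) P)" "invertible G"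
    and m: "proj_point \<circ> (pentagram ^^ m) P = relabel s (proj_map G \<circ> (proj_point \<circ> P))"
  shows "proj_point ((pentagram ^^ (m * k + r)) P i)
    = (proj_map G ^^ k) (proj_point ((pentagram ^^ r) P (i + int k * s)))"
proof -
  \<comment> \<open>The relation for P is propagated to T^r(P) by applying
    \<open>pentagram_proj_map\<close> to T^(m+r)(P) and the relabelled T^r(P).\<close>
  have step: "proj_point ((pentagram ^^ (m + r)) P i)
      = proj_map G (proj_point ((pentagram ^^ r) P (i + s)))" for r i
  proof (induction r arbitrary: i)
    case 0
    show ?case using fun_cong[OF m, of i] by (simp add: relabel_def)
  next
    case (Suc r)
    have gen: "generic_polygon (relabel s ((pentagram ^^ r) P))"
      by (rule generic_polygon_relabel) (rule assms(1))
    have "proj_point (pentagram ((pentagram ^^ (m + r)) P) i)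
        = proj_map G (proj_point (pentagram (relabel s ((pentagram ^^ r) P)) i))"
      by (rule pentagram_proj_map[OF assms(1) gen assms(2)])
        (simp add: Suc.IH relabel_def)
    then show ?case by (simp add: pentagram_relabel) (simp add: relabel_def)
  qed
  show ?thesis
  proof (induction k arbitrary: i)
    case 0
    show ?case by simp
  next
    case (Suc k)
    have "proj_point ((pentagram ^^ (m + (m * k + r))) P i)
      = (proj_map G ^^ Suc k) (proj_point ((pentagram ^^ r) P (i + s + int k * s)))"
      by (simp only: step Suc.IH funpow.simps o_apply)
    then show ?case by (simp add: algebra_simps)
  qed
qed

section \<open>Area-normalized iterates\<close>

text \<open>A unit shift changes the sum by a telescoping difference f(n + s) - f(s), which is zero
  by periodicity; integer induction in both directions gives all shifts.\<close>

lemma sum_periodic_shift: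
  fixes f :: "int \<Rightarrow> 'a::ab_group_add"
  assumes "\<And>i. f (i + int n) = f i"
  shows "(\<Sum>i\<in>{0..<int n}. f (i + s)) = (\<Sum>i\<in>{0..<int n}. f i)"
proof -
  have step: "(\<Sum>i\<in>{0..<int n}. f (i + s + 1)) = (\<Sum>i\<in>{0..<int n}. f (i + s))" for s
  proof -
    have "(\<Sum>i\<in>{0..<int n}. f (i + s)) = (\<Sum>j<n. f (int j + s))" for s
      by (rule sum.reindex_bij_witness[where i = int and j = nat]) auto
    moreover have "(\<Sum>j<n. f (int j + s + 1)) - (\<Sum>j<n. f (int j + s)) = 0"
      using sum_lessThan_telescope[of "\<lambda>j. f (int j + s)" n] assms[of s]
      by (simp add: sum_subtractf add_ac)
    ultimately show ?thesis by (simp add: add.assoc)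
  qed
  show ?thesis
  proof (induction s rule: int_induct[where k = 0])
    case (step1 s) then show ?case using step[of s] by (simp add: add.assoc)
  next
    case (step2 s) then show ?case using step[of "s - 1"] by (simp add: algebra_simps)
  qed simp
qed

lemma polygon_add: "polygon n P \<Longrightarrow> P (i + int n) = P i"
  by (simp add: polygon_def)

lemma centroid_relabel: "polygon n P \<Longrightarrow> centroid n (relabel s P) = centroid n P"
  by (simp add: centroid_def relabel_def sum_periodic_shift polygon_add)

lemma cov_relabel:
  assumes "polygon n P"
  shows "cov n (relabel s P) = cov n P"
  unfolding cov_def centroid_relabel[OF assms] relabel_def
  by (subst sum_periodic_shift[where f = "\<lambda>i. \<chi> a b. (P i - centroid n P) $ a * (P i - centroid n P) $ b"])
    (simp_all add: polygon_add[OF assms])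

lemma centroid_similarity:
  assumes "n > 0"
  shows "centroid n (\<lambda>i. d + c *\<^sub>R P i) = d + c *\<^sub>R centroid n P"
proof -
  have "(\<Sum>i\<in>{0..<int n}. d + c *\<^sub>R P i) = real n *\<^sub>R d + c *\<^sub>R (\<Sum>i\<in>{0..<int n}. P i)"
    by (simp add: sum.distrib sum_constant_scaleR scaleR_right.sum del: sum_constant)
  then show ?thesis using assms by (simp add: centroid_def algebra_simps)
qed

lemma cov_nth: "cov n P $ a $ b
    = (\<Sum>i\<in>{0..<int n}. (P i - centroid n P) $ a * (P i - centroid n P) $ b) / real n"
  by (simp add: cov_def)

lemma cov_similarity:
  assumes "n > 0"
  shows "cov n (\<lambda>i. d + c *\<^sub>R P i) = c\<^sup>2 *\<^sub>R cov n P"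
  unfolding vec_eq_iff vector_scaleR_component cov_nth centroid_similarity[OF assms]
  by (simp add: sum_distrib_left sum_divide_distrib algebra_simps power2_eq_square)

lemma signed_area_similarity:
  assumes "polygon n P"
  shows "signed_area n (\<lambda>i. d + c *\<^sub>R P i) = c\<^sup>2 * signed_area n P"
proof -
  \<comment> \<open>Besides scaling by the square of \<open>c\<close>, the translation adds to each
    summand a difference of values at consecutive vertices; these cancel around the closed
    polygon.\<close>
  have "det2 (d + c *\<^sub>R x) (d + c *\<^sub>R y) = c\<^sup>2 * det2 x y + c * (det2 d y - det2 d x)" for x y
    by (simp add: det2_eq algebra_simps power2_eq_square)
  moreover have "(\<Sum>i\<in>{0..<int n}. det2 d (P (i + 1))) = (\<Sum>i\<in>{0..<int n}. det2 d (P i))"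
    using sum_periodic_shift[of "\<lambda>i. det2 d (P i)" n 1] polygon_add[OF assms] by simp
  ultimately show ?thesis
    by (simp add: signed_area_def sum.distrib sum_subtractf flip: sum_distrib_left)
qed

lemma area_similarity:
  "polygon n P \<Longrightarrow> area n (\<lambda>i. d + c *\<^sub>R P i) = c\<^sup>2 * area n P"
  by (simp add: area_def signed_area_similarity abs_mult)

text \<open>Normalization fixes centroid and area, and the pentagram map commutes with similarities,
  so the successive rescalings merge into one, determined by the areas of P and T^k(P).\<close>

lemma funpow_normalized_pentagram:
  assumes P: "polygon n P"
    and gen: "\<And>k. generic_polygon ((pentagram ^^ k) P)"
    and area: "\<And>k. area n ((pentagram ^^ k) P) \<noteq> 0"
  shows "(normalized_pentagram n ^^ k) P = (\<lambda>i. centroid n P +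
    sqrt (area n P / area n ((pentagram ^^ k) P)) *\<^sub>R
      ((pentagram ^^ k) P i - centroid n ((pentagram ^^ k) P)))"
proof (induction k)
  case 0
  have "area n P \<noteq> 0" using area[of 0] by simp
  then show ?case by simp
next
  case (Suc k)
  have n: "n > 0" using P by (simp add: polygon_def)
  let ?Q = "(pentagram ^^ k) P"
  have Q: "polygon n ?Q" "polygon n (pentagram ?Q)"
    using polygon_funpow_pentagram[OF P] polygon_funpow_pentagram[OF P, of "Suc k"] by simp_all
  have pos: "area n ((pentagram ^^ k) P) > 0" for k
    using area[of k] by (simp add: area_def)
  have pos': "area n P > 0" "area n ?Q > 0" "area n (pentagram ?Q) > 0"
    using pos[of 0] pos[of k] pos[of "Suc k"] by simp_all
  define c where "c = sqrt (area n P / area n ?Q)"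
  define d where "d = centroid n P - c *\<^sub>R centroid n ?Q"
  have c: "c > 0" "c\<^sup>2 * area n ?Q = area n P" using pos' by (simp_all add: c_def)
  have IH: "(normalized_pentagram n ^^ k) P = (\<lambda>i. d + c *\<^sub>R ?Q i)"
    unfolding Suc.IH by (simp add: d_def c_def algebra_simps)
  have T: "pentagram (\<lambda>i. d + c *\<^sub>R ?Q i) = (\<lambda>i. d + c *\<^sub>R pentagram ?Q i)"
    using gen c by (intro pentagram_similarity) auto
  \<comment> \<open>The scale \<open>c\<close> already present in the k-th iterate cancels against
    its effect on the area of the next polygon.\<close>
  have "sqrt (area n P / (c\<^sup>2 * area n (pentagram ?Q))) * c
      = sqrt (area n P / area n (pentagram ?Q))"
    using c by (simp add: real_sqrt_divide real_sqrt_mult)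
  then have "normalized_pentagram n (\<lambda>i. d + c *\<^sub>R ?Q i) i = centroid n P +
      sqrt (area n P / area n (pentagram ?Q)) *\<^sub>R (pentagram ?Q i - centroid n (pentagram ?Q))" for i
    unfolding normalized_pentagram_def T
    by (simp add: centroid_similarity[OF n] area_similarity Q c)
      (simp add: d_def flip: scaleR_diff_right)
  then show ?case by (simp add: IH)
qed

section \<open>Principal lines and symmetric \<open>2 \<times> 2\<close> matrices\<close>

text \<open>For symmetric \<open>M\<close> this is tr^2 - 4 det, the discriminant of the
  characteristic polynomial, written as a sum of squares. The quadratic formula then gives
  eigenvalues that are explicit and continuous in the entries.\<close>

definition disc2 :: "real^2^2 \<Rightarrow> real" where
  "disc2 M = (M $ 1 $ 1 - M $ 2 $ 2)\<^sup>2 + 4 * (M $ 1 $ 2)\<^sup>2"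

definition top_eig2 :: "real^2^2 \<Rightarrow> real" where
  "top_eig2 M = (M $ 1 $ 1 + M $ 2 $ 2 + sqrt (disc2 M)) / 2"

definition bot_eig2 :: "real^2^2 \<Rightarrow> real" where
  "bot_eig2 M = (M $ 1 $ 1 + M $ 2 $ 2 - sqrt (disc2 M)) / 2"

lemma disc2_nonneg: "disc2 M \<ge> 0"
  by (simp add: disc2_def)

lemma eig2_sum: "top_eig2 M + bot_eig2 M = M $ 1 $ 1 + M $ 2 $ 2"
  by (simp add: top_eig2_def bot_eig2_def field_simps)

lemma eig2_prod: "top_eig2 M * bot_eig2 M = M $ 1 $ 1 * M $ 2 $ 2 - (M $ 1 $ 2)\<^sup>2"
proof -
  have "4 * ((x + s) / 2 * ((x - s) / 2)) = x\<^sup>2 - s\<^sup>2" for x s :: real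
    by (simp add: field_simps power2_eq_square)
  then have "4 * (top_eig2 M * bot_eig2 M) = (M $ 1 $ 1 + M $ 2 $ 2)\<^sup>2 - (sqrt (disc2 M))\<^sup>2"
    unfolding top_eig2_def bot_eig2_def .
  also have "\<dots> = 4 * (M $ 1 $ 1 * M $ 2 $ 2 - (M $ 1 $ 2)\<^sup>2)"
    by (simp add: disc2_nonneg) (simp add: disc2_def algebra_simps power2_eq_square)
  finally show ?thesis by simp
qed

lemma charpoly_symmetric2:
  assumes "M $ 2 $ 1 = M $ 1 $ 2"
  shows "charpoly M = [:- top_eig2 M, 1:] * [:- bot_eig2 M, 1:]"
proof -
  have "charpoly M = [:M $ 1 $ 1 * M $ 2 $ 2 - (M $ 1 $ 2)\<^sup>2, - (M $ 1 $ 1 + M $ 2 $ 2), 1:]"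
    by (simp add: charpoly_def det_2 mat_def map_matrix_def assms power2_eq_square)
  then show ?thesis by (simp flip: eig2_sum eig2_prod)
qed

lemma eigenvector2_iff:
  fixes M :: "real^2^2"
  shows "eigenvector M w c \<longleftrightarrow> w \<noteq> 0 \<and> M $ 1 $ 1 * w $ 1 + M $ 1 $ 2 * w $ 2 = c * w $ 1
    \<and> M $ 2 $ 1 * w $ 1 + M $ 2 $ 2 * w $ 2 = c * w $ 2"
  by (simp add: eigenvector_def vec2_eq_iff matrix_vector_mult_def sum_2)

lemma eigenvalue_symmetric2_cases:
  assumes "M $ 2 $ 1 = M $ 1 $ 2" "eigenvector M w d"
  shows "d = top_eig2 M \<or> d = bot_eig2 M"
proof -
  let ?p = "M $ 1 $ 1" and ?q = "M $ 1 $ 2" and ?s = "M $ 2 $ 2"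
  have e: "w \<noteq> 0" "?p * w $ 1 + ?q * w $ 2 = d * w $ 1" "?q * w $ 1 + ?s * w $ 2 = d * w $ 2"
    using assms by (simp_all add: eigenvector2_iff)
  \<comment> \<open>The characteristic polynomial at \<open>d\<close>; it annihilates both
    coordinates of \<open>w\<close>, one of which is nonzero.\<close>
  let ?k = "(d - ?p) * (d - ?s) - ?q\<^sup>2"
  have "?k * w $ 1 = 0" "?k * w $ 2 = 0" using e(2,3) by algebra+
  with e(1) have "?k = 0" by (auto simp: vec2_eq_iff)
  moreover have "(d - top_eig2 M) * (d - bot_eig2 M) = ?k"
    using eig2_sum[of M] eig2_prod[of M] by algebra
  ultimately show ?thesis by auto
qed

text \<open>
  By Cayley--Hamilton, \<open>M - bot_eig2 M\<close> maps every vector into the eigenspace of \<open>top_eig2 M\<close>;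
  unlike a choice of unit eigenvector, its value at a fixed vector depends continuously on \<open>M\<close>.
\<close>

definition top_eigvec2 :: "real^2^2 \<Rightarrow> real^2 \<Rightarrow> real^2" where
  "top_eigvec2 M u = M *v u - bot_eig2 M *\<^sub>R u"

lemma eigenvector_top_eigvec2:
  assumes "M $ 2 $ 1 = M $ 1 $ 2" "top_eigvec2 M u \<noteq> 0"
  shows "eigenvector M (top_eigvec2 M u) (top_eig2 M)"
proof -
  \<comment> \<open>Free variables \<open>z1\<close>, \<open>z2\<close> stand for the coordinates,
    so that Cayley-Hamilton becomes a polynomial consequence of the trace and determinant
    relations.\<close>
  have "M $ 1 $ 1 * z1 + M $ 1 $ 2 * z2 = top_eig2 M * z1 \<and>
        M $ 1 $ 2 * z1 + M $ 2 $ 2 * z2 = top_eig2 M * z2"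
    if "z1 = M $ 1 $ 1 * u $ 1 + M $ 1 $ 2 * u $ 2 - bot_eig2 M * u $ 1"
      "z2 = M $ 1 $ 2 * u $ 1 + M $ 2 $ 2 * u $ 2 - bot_eig2 M * u $ 2" for z1 z2
    using that eig2_sum[of M] eig2_prod[of M] by algebra
  then show ?thesis
    using assms by (simp add: eigenvector2_iff top_eigvec2_def matrix_vector_mult_def sum_2)
qed

text \<open>Two independent eigenvectors for one eigenvalue would force \<open>M\<close> to be
  scalar, with discriminant zero.\<close>

lemma top_eigenvectors_parallel:
  assumes "M $ 2 $ 1 = M $ 1 $ 2" "disc2 M > 0" "eigenvector M w c" "eigenvector M z c"
  shows "det2 w z = 0"
proof (rule ccontr)
  let ?D = "det2 w z"
  assume D: "?D \<noteq> 0"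
  have w: "M $ 1 $ 1 * w $ 1 + M $ 1 $ 2 * w $ 2 = c * w $ 1"
      "M $ 1 $ 2 * w $ 1 + M $ 2 $ 2 * w $ 2 = c * w $ 2"
    and z: "M $ 1 $ 1 * z $ 1 + M $ 1 $ 2 * z $ 2 = c * z $ 1"
      "M $ 1 $ 2 * z $ 1 + M $ 2 $ 2 * z $ 2 = c * z $ 2"
    using assms by (simp_all add: eigenvector2_iff)
  have "(M $ 1 $ 1 - c) * ?D = 0" "M $ 1 $ 2 * ?D = 0" "(M $ 2 $ 2 - c) * ?D = 0"
    unfolding det2_eq using w z by algebra+
  with D have "disc2 M = 0" by (simp add: disc2_def)
  with assms(2) show False by simp
qed

section \<open>Directions of affine lines and the principal line\<close>

lemma affine_line_eq: "affine_line c w = (+) c ` span {w}"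
  by (auto simp: affine_line_def span_singleton)

lemma line_dir_affine_line: "line_dir (affine_line c w) = span {w}"
proof (intro subset_antisym subsetI)
  fix x assume "x \<in> line_dir (affine_line c w)"
  then obtain p q where "p \<in> span {w}" "q \<in> span {w}" "x = (c + p) - (c + q)"
    unfolding line_dir_def affine_line_eq by blast
  then show "x \<in> span {w}" by (simp add: span_diff)
next
  fix x assume "x \<in> span {w}"
  moreover have "x = (c + x) - (c + 0)" by simp
  ultimately show "x \<in> line_dir (affine_line c w)"
    unfolding line_dir_def affine_line_eq using span_0 by blast
qed

lemma cov_symmetric: "cov n P $ 2 $ 1 = cov n P $ 1 $ 2"
  by (simp add: cov_nth mult.commute)

text \<open>The vector \<open>u\<close> is a probe: whenever its \<open>top_eigvec2\<close> is
  nonzero, it spans the top eigenline. Positive discriminant separates the two eigenvalues, which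
  gives simplicity and uniqueness of the line.\<close>

lemma principal_line_top_eigvec2:
  assumes "disc2 (cov n P) > 0" "top_eigvec2 (cov n P) u \<noteq> 0"
  shows "principal_line_defined n P"
    and "line_dir (principal_line n P) = span {top_eigvec2 (cov n P) u}"
proof -
  define M where "M = cov n P"
  define z where "z = top_eigvec2 M u"
  have sym: "M $ 2 $ 1 = M $ 1 $ 2" by (simp add: M_def cov_symmetric)
  have disc: "disc2 M > 0" and z0: "z \<noteq> 0" using assms by (simp_all add: M_def z_def)
  have lt: "bot_eig2 M < top_eig2 M" using disc by (simp add: top_eig2_def bot_eig2_def)
  have ev: "eigenvector M z (top_eig2 M)"
    unfolding z_def by (rule eigenvector_top_eigvec2) (use sym z0 in \<open>auto simp: z_def\<close>)
  have largest: "largest_eigenvalue M (top_eig2 M)"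
    unfolding largest_eigenvalue_def eigenvalue_def
    using ev eigenvalue_symmetric2_cases[OF sym] lt by force
  have uniq: "c = top_eig2 M" if "largest_eigenvalue M c" for c
    using that largest unfolding largest_eigenvalue_def by (meson order_antisym)
  \<comment> \<open>The multiplicity splits over the two linear factors as 1 + 0, since the smaller
    eigenvalue is a different root.\<close>
  have "charpoly M \<noteq> 0" by (simp add: charpoly_symmetric2[OF sym])
  then have "order (top_eig2 M) (charpoly M)
      = order (top_eig2 M) [:- top_eig2 M, 1:] + order (top_eig2 M) [:- bot_eig2 M, 1:]"
    unfolding charpoly_symmetric2[OF sym] by (rule order_mult)
  also have "order (top_eig2 M) [:- bot_eig2 M, 1:] = 0"
    using lt by (intro order_0I) simp
  also have "order (top_eig2 M) [:- top_eig2 M, 1:] = 1"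
    using order_power_n_n[of "top_eig2 M" 1] by simp
  finally have simple: "simple_eigenvalue M (top_eig2 M)"
    by (simp add: simple_eigenvalue_def)
  show "principal_line_defined n P"
    unfolding principal_line_defined_def using largest simple by (auto simp: M_def)
  let ?l = "affine_line (centroid n P) z"
  have "principal_line n P = ?l"
    unfolding principal_line_def
  proof (rule the_equality)
    \<comment> \<open>The definition of the principal line asks for a unit vector; rescaling
      \<open>z\<close> leaves the line unchanged.\<close>
    have "eigenvector M (z /\<^sub>R norm z) (top_eig2 M)"
      using ev by (simp add: eigenvector_def matrix_vector_mult_scaleR vector_scalar_commute
          scalar_mult_eq_scaleR)
    moreover have "?l = affine_line (centroid n P) (z /\<^sub>R norm z)"
      using z0 by (simp add: affine_line_eq span_singleton_scaleR)
    ultimately show "is_principal_line n P ?l"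
      unfolding is_principal_line_def using largest simple z0
      by (intro exI[where x = "top_eig2 M"] exI[where x = "z /\<^sub>R norm z"]) (simp flip: M_def)
  next
    fix l assume "is_principal_line n P l"
    then obtain w where w: "eigenvector M w (top_eig2 M)" "l = affine_line (centroid n P) w"
      unfolding is_principal_line_def by (auto simp flip: M_def dest: uniq)
    then obtain k where k: "w = k *\<^sub>R z"
      using top_eigenvectors_parallel[OF sym disc w(1) ev] z0 by (auto elim: det2_eq_0_imp_multiple)
    moreover from k w(1) have "k \<noteq> 0" by (auto simp: eigenvector_def)
    ultimately show "l = ?l" by (simp add: w(2) affine_line_eq span_singleton_scaleR)
  qed
  then show "line_dir (principal_line n P) = span {top_eigvec2 (cov n P) u}"
    by (simp add: line_dir_affine_line z_def M_def)
qed

section \<open>Continuity of the principal direction\<close>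

lemma disc2_scaleR: "disc2 (t *\<^sub>R M) = t\<^sup>2 * disc2 M"
  by (simp add: disc2_def algebra_simps power2_eq_square)

text \<open>The square root of t^2 is the absolute value of t, so a negative factor would
  interchange the two eigenvalues.\<close>

lemma top_eigvec2_scaleR: "t \<ge> 0 \<Longrightarrow> top_eigvec2 (t *\<^sub>R M) u = t *\<^sub>R top_eigvec2 M u"
  by (simp add: top_eigvec2_def bot_eig2_def disc2_scaleR real_sqrt_mult scaleR_matrix_vector_assoc
      algebra_simps flip: scaleR_matrix_vector_assoc)

text \<open>The limit matrix is rank one with eigenvalues \<kappa> |u|^2 and 0, so the spectral gap
  persists and \<open>top_eigvec2\<close> at the probe \<open>u\<close> tends to a positive multiple
  of \<open>u\<close>. The factors \<open>t k\<close> secure a limit without moving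
  eigenlines.\<close>

lemma eventually_principal_line_dir:
  assumes t: "\<And>k. t k > 0" and "u \<noteq> 0" "\<kappa> > 0"
    and lim: "\<And>a b. (\<lambda>k. t k * cov n (Q k) $ a $ b) \<longlonglongrightarrow> \<kappa> * (u $ a * u $ b)"
    and U: "openin RP1 U" "span {u} \<in> U"
  shows "\<forall>\<^sub>F k in sequentially. principal_line_defined n (Q k) \<and> line_dir (principal_line n (Q k)) \<in> U"
proof -
  define M where "M k = t k *\<^sub>R cov n (Q k)" for k
  define N where "N = (\<chi> a b. \<kappa> * (u $ a * u $ b))"
  have M: "(\<lambda>k. M k $ a $ b) \<longlonglongrightarrow> N $ a $ b" for a b
    using lim[of a b] by (simp add: M_def N_def)
  have disc: "(\<lambda>k. disc2 (M k)) \<longlonglongrightarrow> disc2 N"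
    unfolding disc2_def by (intro tendsto_intros M)
  define r where "r = (u $ 1)\<^sup>2 + (u $ 2)\<^sup>2"
  have r: "r > 0"
    using \<open>u \<noteq> 0\<close> unfolding r_def by (simp add: vec2_eq_iff sum_power2_gt_zero_iff)
  have discN: "disc2 N = (\<kappa> * r)\<^sup>2"
    by (simp add: disc2_def N_def r_def algebra_simps power2_eq_square)
  have botN: "bot_eig2 N = 0"
    using r \<open>\<kappa> > 0\<close> by (simp add: bot_eig2_def discN) (simp add: N_def r_def algebra_simps power2_eq_square)
  have bot: "(\<lambda>k. bot_eig2 (M k)) \<longlonglongrightarrow> bot_eig2 N"
    unfolding bot_eig2_def by (intro tendsto_intros M disc) simp
  have "(\<lambda>k. top_eigvec2 (M k) u) \<longlonglongrightarrow> top_eigvec2 N u"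
    by (intro vec_tendstoI)
      (simp add: top_eigvec2_def matrix_vector_mult_def sum_2, intro tendsto_intros M bot)
  moreover have "top_eigvec2 N u = (\<kappa> * r) *\<^sub>R u"
    unfolding top_eigvec2_def botN by (simp add: N_def r_def vec2_eq_iff matrix_vector_mult_def sum_2
        algebra_simps power2_eq_square)
  ultimately have z: "(\<lambda>k. top_eigvec2 (M k) u) \<longlonglongrightarrow> (\<kappa> * r) *\<^sub>R u" by simp
  \<comment> \<open>By the quotient topology \<open>U\<close> pulls back to an open set of nonzero
    vectors, so convergence of vectors suffices and no sign has to be chosen.\<close>
  have "open {x. x \<noteq> 0 \<and> span {x} \<in> U}"
    using U(1) by (simp add: openin_projective_topology)
  moreover have "(\<kappa> * r) *\<^sub>R u \<in> {x. x \<noteq> 0 \<and> span {x} \<in> U}"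
    using U(2) r assms(2,3) by (simp add: span_singleton_scaleR)
  ultimately have "\<forall>\<^sub>F k in sequentially. top_eigvec2 (M k) u \<in> {x. x \<noteq> 0 \<and> span {x} \<in> U}"
    by (rule topological_tendstoD[OF z])
  moreover have "\<forall>\<^sub>F k in sequentially. disc2 (M k) > 0"
    using disc by (rule order_tendstoD) (use r assms(3) in \<open>simp add: discN\<close>)
  ultimately show ?thesis
  proof eventually_elim
    case (elim k)
    have tk: "t k > 0" by (rule t)
    have "disc2 (cov n (Q k)) > 0"
      using elim(2) tk by (simp add: M_def disc2_scaleR zero_less_mult_iff)
    moreover have e: "top_eigvec2 (M k) u = t k *\<^sub>R top_eigvec2 (cov n (Q k)) u"
      using tk by (simp add: M_def top_eigvec2_scaleR)
    moreover have "top_eigvec2 (cov n (Q k)) u \<noteq> 0" using elim(1) e by auto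
    ultimately show ?case
      using principal_line_top_eigvec2[of n "Q k" u] elim(1) tk by (simp add: span_singleton_scaleR)
  qed
qed

section \<open>Convergence\<close>

text \<open>After division by \<open>\<alpha> k\<close> the v-components die out, because
  \<beta>/\<alpha> tends to 0. The centered vertices then tend to multiples \<open>a i\<close> of
  \<open>u\<close>, and \<kappa> is the mean square of the \<open>a i\<close>.\<close>

lemma two_scale_cov_limit:
  assumes "area_nondegenerate_two_scale n u Q"
  obtains t \<kappa> where "\<And>k. t k > 0" "\<kappa> > 0"
    "\<And>a b. (\<lambda>k. t k * cov n (Q k) $ a $ b) \<longlonglongrightarrow> \<kappa> * (u $ a * u $ b)"
proof -
  obtain v \<alpha> \<beta> a b where ts: "two_scale_asymptotic n u Q v \<alpha> \<beta> a b"
    and sa: "signed_area n (\<lambda>i. a i *\<^sub>R u + b i *\<^sub>R v) \<noteq> 0"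
    using assms unfolding area_nondegenerate_two_scale_def by blast
  obtain x y where Q: "\<And>k. polygon n (Q k)" and nz: "\<And>k. \<alpha> k \<noteq> 0" "\<And>k. \<beta> k \<noteq> 0" and "u \<noteq> 0"
    and xy: "\<And>k i. Q k i - centroid n (Q k) = x k i *\<^sub>R u + y k i *\<^sub>R v"
    and xa: "\<And>i. (\<lambda>k. x k i / \<alpha> k) \<longlonglongrightarrow> a i" and yb: "\<And>i. (\<lambda>k. y k i / \<beta> k) \<longlonglongrightarrow> b i"
    and ba: "(\<lambda>k. \<bar>\<beta> k\<bar> / \<bar>\<alpha> k\<bar>) \<longlonglongrightarrow> 0"
    using ts unfolding two_scale_asymptotic_def by blast
  have n: "n > 0" using Q[of 0] by (simp add: polygon_def)
  have "(\<lambda>k. \<beta> k / \<alpha> k) \<longlonglongrightarrow> 0"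
    using ba by (subst tendsto_rabs_zero_iff[symmetric]) simp
  then have "(\<lambda>k. (y k i / \<beta> k) * (\<beta> k / \<alpha> k)) \<longlonglongrightarrow> b i * 0" for i
    by (intro tendsto_mult yb)
  then have ya: "(\<lambda>k. y k i / \<alpha> k) \<longlonglongrightarrow> 0" for i
    using nz by simp
  have "(\<lambda>k. (x k i / \<alpha> k) *\<^sub>R u + (y k i / \<alpha> k) *\<^sub>R v) \<longlonglongrightarrow> a i *\<^sub>R u + 0 *\<^sub>R v" for i
    by (intro tendsto_intros xa ya)
  moreover have "(x k i / \<alpha> k) *\<^sub>R u + (y k i / \<alpha> k) *\<^sub>R v = (Q k i - centroid n (Q k)) /\<^sub>R \<alpha> k" for k i
    by (simp add: xy scaleR_add_right divide_inverse_commute)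
  ultimately have lim: "(\<lambda>k. (Q k i - centroid n (Q k)) /\<^sub>R \<alpha> k) \<longlonglongrightarrow> a i *\<^sub>R u" for i
    by simp
  \<comment> \<open>Index n occurs in the last summand of the signed area, so the vanishing of
    \<open>a\<close> on one period must be carried over to it.\<close>
  have periodic: "a (i + int n) = a i" for i
  proof -
    have "(\<lambda>k. (Q k i - centroid n (Q k)) /\<^sub>R \<alpha> k) \<longlonglongrightarrow> a (i + int n) *\<^sub>R u"
      using lim[of "i + int n"] by (simp only: polygon_add[OF Q])
    then have "a (i + int n) *\<^sub>R u = a i *\<^sub>R u"
      by (rule LIMSEQ_unique) (rule lim)
    then show ?thesis using \<open>u \<noteq> 0\<close> by simp
  qed
  define \<kappa> where "\<kappa> = (\<Sum>i\<in>{0..<int n}. (a i)\<^sup>2) / real n"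
  \<comment> \<open>Otherwise all limiting vertices would be multiples of \<open>v\<close>, and
    every determinant in the signed area would be zero.\<close>
  have "\<exists>i\<in>{0..<int n}. a i \<noteq> 0"
  proof (rule ccontr)
    assume "\<not> (\<exists>i\<in>{0..<int n}. a i \<noteq> 0)"
    then have z: "\<And>i. i \<in> {0..<int n} \<Longrightarrow> a i = 0" by blast
    have "a (i + 1) = 0" if "i \<in> {0..<int n}" for i
    proof (cases "i + 1 = int n")
      case True then show ?thesis using periodic[of 0] z[of 0] n by simp
    next
      case False with that show ?thesis by (intro z) auto
    qed
    with z have "signed_area n (\<lambda>i. a i *\<^sub>R u + b i *\<^sub>R v) = 0"
      unfolding signed_area_def by (simp add: det2_eq)
    with sa show False by simp
  qed
  then obtain i where "i \<in> {0..<int n}" "a i \<noteq> 0" by blast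
  then have "(\<Sum>i\<in>{0..<int n}. (a i)\<^sup>2) > 0" by (intro sum_pos2[of _ i]) auto
  then have \<kappa>: "\<kappa> > 0" using n by (simp add: \<kappa>_def)
  have pos: "(1 / \<alpha> k)\<^sup>2 > 0" for k using nz by simp
  have "(\<lambda>k. (1 / \<alpha> k)\<^sup>2 * cov n (Q k) $ j $ l) \<longlonglongrightarrow> \<kappa> * (u $ j * u $ l)" for j l
  proof -
    have "(\<lambda>k. (\<Sum>i\<in>{0..<int n}. ((Q k i - centroid n (Q k)) /\<^sub>R \<alpha> k) $ j *
        ((Q k i - centroid n (Q k)) /\<^sub>R \<alpha> k) $ l) / real n)
      \<longlonglongrightarrow> (\<Sum>i\<in>{0..<int n}. (a i *\<^sub>R u) $ j * (a i *\<^sub>R u) $ l) / real n"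
      using n by (intro tendsto_intros lim tendsto_vec_nth) simp
    moreover have "(\<Sum>i\<in>{0..<int n}. (a i *\<^sub>R u) $ j * (a i *\<^sub>R u) $ l) / real n = \<kappa> * (u $ j * u $ l)"
      by (simp add: \<kappa>_def sum_distrib_left sum_divide_distrib power2_eq_square mult_ac)
    moreover have "(\<Sum>i\<in>{0..<int n}. ((Q k i - centroid n (Q k)) /\<^sub>R \<alpha> k) $ j *
        ((Q k i - centroid n (Q k)) /\<^sub>R \<alpha> k) $ l) / real n = (1 / \<alpha> k)\<^sup>2 * cov n (Q k) $ j $ l" for k
      unfolding cov_nth by (simp add: sum_distrib_left sum_divide_distrib power2_eq_square
          divide_inverse mult_ac)
    ultimately show ?thesis by simp
  qed
  then show ?thesis by (rule that[OF pos \<kappa>])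
qed

text \<open>The finitely many residues share a threshold \<open>K\<close>, and every index from
  \<open>m * K\<close> on has quotient at least \<open>K\<close>.\<close>

lemma eventually_sequentially_residues:
  assumes "m > 0" "\<And>r. r < m \<Longrightarrow> \<forall>\<^sub>F k in sequentially. A (m * k + r)"
  shows "\<forall>\<^sub>F k in sequentially. A (k :: nat)"
proof -
  have "\<forall>\<^sub>F k in sequentially. \<forall>r\<in>{..<m}. A (m * k + r)"
    using assms(2) by (intro eventually_ball_finite) auto
  then obtain K where K: "\<And>k r. k \<ge> K \<Longrightarrow> r < m \<Longrightarrow> A (m * k + r)"
    unfolding eventually_sequentially by blast
  have "A N" if "N \<ge> m * K" for N
  proof -
    have "N div m \<ge> K" using div_le_mono[OF that, of m] assms(1) by simp
    then have "A (m * (N div m) + N mod m)" using assms(1) by (intro K) auto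
    then show ?thesis by simp
  qed
  then show ?thesis unfolding eventually_sequentially by blast
qed

theorem theorem5p11:
  fixes n m :: nat and s :: int and P :: "int \<Rightarrow> real^2" and G :: "real^3^3"
    and l\<^sub>G :: "(real^3) set set" and u :: "real^2"
  assumes "polygon n P" and "area n P > 0"
    and "\<And>k. pentagram_defined ((pentagram ^^ k) P) \<and> area n ((pentagram ^^ k) P) \<noteq> 0"
    and "m \<ge> 1" and "invertible G"
    and "proj_point \<circ> (pentagram ^^ m) P = relabel s (proj_map G \<circ> (proj_point \<circ> P))"
    and "dominant_spectral_line G l\<^sub>G" and "finite_affine_direction l\<^sub>G u"
    and "\<And>r. r < m \<Longrightarrow> area_nondegenerate_two_scale_under n G u ((pentagram ^^ r) P)"
  shows "(\<forall>\<^sub>F k in sequentially. principal_line_defined n ((normalized_pentagram n ^^ k) P)) \<and>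
    limitin RP1 (\<lambda>k. line_dir (principal_line n ((normalized_pentagram n ^^ k) P)))
      (span {u}) sequentially \<and>
    limitin RP1 (\<lambda>k. line_dir (principal_line n ((normalized_pentagram n ^^ k) P)))
      (line_dir (affine_line (centroid n P) u)) sequentially"
proof -
  have n: "n > 0" using assms(1) by (simp add: polygon_def)
  have u: "u \<noteq> 0" using assms(8) by (simp add: finite_affine_direction_def)
  have gen: "generic_polygon ((pentagram ^^ k) P)" for k
    using assms(3) by (blast intro: pentagram_defined_imp_generic)
  let ?N = "\<lambda>k. (normalized_pentagram n ^^ k) P"
  \<comment> \<open>The normalized iterate is a similar copy of the plain one; the factor is the
    square of the scale, and only its positivity matters later.\<close>
  have cov_N: "\<exists>c>0. cov n (?N k) = c *\<^sub>R cov n ((pentagram ^^ k) P)" for k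
  proof -
    let ?c = "sqrt (area n P / area n ((pentagram ^^ k) P))"
    have "?N k = (\<lambda>i. (centroid n P - ?c *\<^sub>R centroid n ((pentagram ^^ k) P))
        + ?c *\<^sub>R (pentagram ^^ k) P i)"
      using assms(1,3) gen by (subst funpow_normalized_pentagram) (auto simp: algebra_simps)
    then have "cov n (?N k) = ?c\<^sup>2 *\<^sub>R cov n ((pentagram ^^ k) P)"
      by (simp only: cov_similarity[OF n])
    moreover have "area n ((pentagram ^^ k) P) > 0"
      using assms(3)[of k] by (simp add: area_def)
    then have "?c\<^sup>2 > 0" using assms(2) by simp
    ultimately show ?thesis by blast
  qed
  have ev: "\<forall>\<^sub>F k in sequentially. principal_line_defined n (?N k) \<and> line_dir (principal_line n (?N k)) \<in> U"
    if U: "openin RP1 U" "span {u} \<in> U" for U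
  proof (rule eventually_sequentially_residues[of m])
    show "m > 0" using assms(4) by simp
    fix r assume "r < m"
    then obtain R where R: "\<And>k i. proj_point (R k i) = (proj_map G ^^ k) (proj_point ((pentagram ^^ r) P i))"
      and R2: "area_nondegenerate_two_scale n u R"
      using assms(9) unfolding area_nondegenerate_two_scale_under_def by blast
    have poly: "polygon n (R k)" for k
      using R2 unfolding area_nondegenerate_two_scale_def two_scale_asymptotic_def by blast
    \<comment> \<open>Injectivity of \<open>proj_point\<close> turns the projective identity into
      equality of planar polygons, up to a shift that leaves the covariance unchanged.\<close>
    have "(pentagram ^^ (m * k + r)) P = relabel (int k * s) (R k)" for k
      using pentagram_iterates_proj_map[OF gen assms(5,6), of k r]
      by (intro ext) (simp add: relabel_def injD[OF inj_proj_point] flip: R)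
    then have cov_T: "cov n ((pentagram ^^ (m * k + r)) P) = cov n (R k)" for k
      using poly by (simp add: cov_relabel)
    obtain c where c: "\<And>k. c k > 0" "\<And>k. cov n (?N k) = c k *\<^sub>R cov n ((pentagram ^^ k) P)"
      using cov_N by metis
    obtain t \<kappa> where t: "\<And>k. t k > 0" "\<kappa> > 0"
      "\<And>a b. (\<lambda>k. t k * cov n (R k) $ a $ b) \<longlonglongrightarrow> \<kappa> * (u $ a * u $ b)"
      using two_scale_cov_limit[OF R2] by blast
    show "\<forall>\<^sub>F k in sequentially. principal_line_defined n (?N (m * k + r)) \<and>
        line_dir (principal_line n (?N (m * k + r))) \<in> U"
    proof (rule eventually_principal_line_dir[OF _ u t(2) _ U])
      \<comment> \<open>Dividing by \<open>c\<close> cancels the area-normalization factor, so the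
        covariance limit for \<open>R\<close> carries over.\<close>
      show "t k / c (m * k + r) > 0" for k using t c by simp
      have "c (m * k + r) \<noteq> 0" for k using c(1)[of "m * k + r"] by simp
      then show "(\<lambda>k. t k / c (m * k + r) * cov n (?N (m * k + r)) $ a $ b)
          \<longlonglongrightarrow> \<kappa> * (u $ a * u $ b)" for a b
        using t(3)[of a b] by (simp add: c(2) cov_T)
    qed
  qed
  have top: "span {u} \<in> topspace RP1"
    using u by (auto simp: topspace_projective_topology projectivization_def)
  \<comment> \<open>Definedness is extracted by taking the whole projective line as the
    neighbourhood.\<close>
  have "\<forall>\<^sub>F k in sequentially. principal_line_defined n (?N k)"
    by (rule eventually_mono[OF ev[OF openin_topspace top]]) simp
  moreover have "limitin RP1 (\<lambda>k. line_dir (principal_line n (?N k))) (span {u}) sequentially"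
    unfolding limitin_def
  proof (intro conjI allI impI top)
    fix U assume U: "openin RP1 U \<and> span {u} \<in> U"
    show "\<forall>\<^sub>F k in sequentially. line_dir (principal_line n (?N k)) \<in> U"
      by (rule eventually_mono[OF ev[of U]]) (use U in auto)
  qed
  ultimately show ?thesis by (simp add: line_dir_affine_line)
qed

end
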